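(* Let $G$ be a simple graph on $d\ge 1$ vertices and let $C_5$ be a chordless $5$-cycle (vertex-disjoint from $G$). Let $G'$ be the graph obtained by choosing an edge $E$ of $C_5$ and connecting both endpoints of $E$ to every vertex of $G$; that is, the vertices of $G'$ are those of $C_5$ and of $G$, and its edges are the edges of $C_5$, the edges of $G$, and all edges joining an endpoint of $E$ to a vertex of $G$. Then $G'$ admits an exotic solution.
   Context: For a finite simple graph $H$ with vertices $v_0,\ldots,v_{n-1}$, let $H_i$ be the set of vertices adjacent to $v_i$. The homogeneous Kuramoto system on $H$ is $\dot\theta_i=\sum_{v_j\in H_i}\sin(\theta_j-\theta_i)$, $0\le i\le n-1$. A solution (equilibrium) is $p=(\theta_0^*,\ldots,\theta_{n-1}^* )\in\mathbb{R}^n$ with $\sum_{v_j\in H_i}\sin(\theta_j^*-\theta_i^* )=0$ for all $i$. The Jacobian $J(p)$ is the $n\times n$ matrix of partial derivatives of the right-hand sides with respect to $\theta_0,\ldots,\theta_{n-1}$, evaluated at $p$; it is symmetric with zero row sums, so it always has $0$ as an eigenvalue. The solution $p$ is linearly stable if all but one of the eigenvalues of $J(p)$ (counted with multiplicity) are negative. An exotic solution is a linearly stable solution in which the angles $\theta_i^*$ are not all equal (modulo $2\pi$). *)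

theory Defs
  imports
    "HOL-Analysis.Analysis"
    "HOL-Library.Real_Mod"
    "Jordan_Normal_Form.Char_Poly"
    "Graph_Theory.Pair_Digraph"
begin

text \<open>
  Finite simple graphs are the \<^locale>\<open>pair_graph\<close>s of the graph library: finite, loop-free
  digraphs with a symmetric arc relation.  An edge joining \<open>u\<close> and \<open>v\<close> is thus the pair of arcs
  \<open>(u, v)\<close> and \<open>(v, u)\<close>.
\<close>

definition neighbours :: "'a pair_pre_digraph \<Rightarrow> 'a \<Rightarrow> 'a set" where
  "neighbours H v = {w. (v, w) \<in> parcs H}"

definition kuramoto :: "'a pair_pre_digraph \<Rightarrow> ('a \<Rightarrow> real) \<Rightarrow> 'a \<Rightarrow> real" where
  "kuramoto H \<theta> v = (\<Sum>w\<in>neighbours H v. sin (\<theta> w - \<theta> v))"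

definition equilibrium :: "'a pair_pre_digraph \<Rightarrow> ('a \<Rightarrow> real) \<Rightarrow> bool" where
  "equilibrium H \<theta> \<longleftrightarrow> (\<forall>v\<in>pverts H. kuramoto H \<theta> v = 0)"

text \<open>
  The list \<open>vs\<close> enumerates the vertices; it fixes the order of the rows and columns.
\<close>

definition kuramoto_jacobian :: "'a pair_pre_digraph \<Rightarrow> 'a list \<Rightarrow> ('a \<Rightarrow> real) \<Rightarrow> real mat" where
  "kuramoto_jacobian H vs \<theta> = mat (length vs) (length vs)
     (\<lambda>(i, j). deriv (\<lambda>t. kuramoto H (\<theta>(vs ! j := t)) (vs ! i)) (\<theta> (vs ! j)))"

text \<open>
  All but one of the \<open>n\<close> eigenvalues are negative: counted with algebraic multiplicity, exactly
  \<open>n - 1\<close> roots of the characteristic polynomial are negative reals.  The spectrum does not depend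
  on the enumeration, so the condition is imposed for every one of them; at least one exists
  because the graphs considered are finite.
\<close>

definition linearly_stable :: "'a pair_pre_digraph \<Rightarrow> ('a \<Rightarrow> real) \<Rightarrow> bool" where
  "linearly_stable H \<theta> \<longleftrightarrow>
     (\<forall>vs. distinct vs \<and> set vs = pverts H \<longrightarrow>
       Suc (size {#x \<in># proots (char_poly (kuramoto_jacobian H vs \<theta>)). x < 0#}) = length vs)"

definition exotic_solution :: "'a pair_pre_digraph \<Rightarrow> ('a \<Rightarrow> real) \<Rightarrow> bool" where
  "exotic_solution H \<theta> \<longleftrightarrow> equilibrium H \<theta> \<and> linearly_stable H \<theta> \<and>
     \<not> (\<forall>v\<in>pverts H. \<forall>w\<in>pverts H. [\<theta> v = \<theta> w] (rmod (2 * pi)))"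

text \<open>The edges are exactly the ones between cyclically consecutive vertices (no chords).\<close>

definition cycle_graph :: "'a list \<Rightarrow> 'a pair_pre_digraph" where
  "cycle_graph vs =
     (let n = length vs; next = (\<lambda>i. vs ! (Suc i mod n))
      in \<lparr>pverts = set vs, parcs = (\<Union>i<n. {(vs ! i, next i), (next i, vs ! i)})\<rparr>)"

definition is_cycle_graph :: "nat \<Rightarrow> 'a pair_pre_digraph \<Rightarrow> bool" where
  "is_cycle_graph n C \<longleftrightarrow> (\<exists>vs. distinct vs \<and> length vs = n \<and> C = cycle_graph vs)"

definition join_to_edge ::
  "'a pair_pre_digraph \<Rightarrow> 'a \<times> 'a \<Rightarrow> 'a pair_pre_digraph \<Rightarrow> 'a pair_pre_digraph" where
  "join_to_edge C e G =
     \<lparr>pverts = pverts C \<union> pverts G,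
      parcs = parcs C \<union> parcs G \<union> ({fst e, snd e} \<times> pverts G) \<union> (pverts G \<times> {fst e, snd e})\<rparr>"

end

theory Submission
  imports
    Defs
    "Jordan_Normal_Form.Schur_Decomposition"
    "HOL-Computational_Algebra.Fundamental_Theorem_Algebra"
begin

text \<open>
  The exotic solution is a twisted state of the five-cycle \<open>a, b, c, d, f\<close>: the angle increases once
  by \<open>2 * pi\<close> around the cycle.  Let \<open>a\<close>, \<open>b\<close> be the ends of the distinguished edge.  Place
  them symmetrically at \<open>- s\<close> and \<open>s\<close> and all vertices of \<open>G\<close> in the middle, at \<open>0\<close>.  A vertex of
  \<open>G\<close> is then in balance: its neighbours in \<open>G\<close> share its angle, and \<open>a\<close> and \<open>b\<close> pull on it in
  opposite directions.  Divide the remaining angle evenly, with step \<open>\<beta> = (pi - s) / 2\<close>, among the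
  other four edges, so that \<open>c\<close>, \<open>d\<close> and \<open>f\<close> are in balance too.  Balance at \<open>a\<close> and at \<open>b\<close>
  amounts to the same single equation \<open>sin (2 * s) + n * sin s = sin \<beta>\<close>, where \<open>n\<close> is the number of
  vertices of \<open>G\<close>.  By the intermediate value theorem it has a solution with
  \<open>0 < s \<le> pi / 5\<close> (lemma \<open>ex_half_angle\<close>); the angles \<open>- s\<close> and \<open>s\<close> differ modulo \<open>2 * pi\<close>.

  For such \<open>s\<close>, neighbouring angles differ modulo \<open>2 * pi\<close> by \<open>0\<close>, \<open>s\<close>, \<open>2 * s\<close> or
  \<open>\<beta>\<close> up to sign, all less than \<open>pi / 2\<close>, so every edge has a positive cosine.  The Jacobian is the
  negated graph Laplacian with these cosines as weights (lemma \<open>kuramoto_jacobian_eq_laplacian\<close>).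
  Its quadratic form is a negated sum of squares of differences along edges; on a connected graph it
  is negative semidefinite with only the constant vectors in the kernel.

  Stability counts roots of the characteristic polynomial, that is algebraic multiplicities.  The
  lemma \<open>neg_semidefinite_simple_kernel_spectrum\<close> derives this count from symmetry: all roots
  are real, none is positive, and a double root \<open>0\<close> would, after triangularization, produce a
  Jordan chain \<open>A x = 0\<close>, \<open>A y = b x\<close>, which symmetry reduces to two independent vectors
  in a one-dimensional kernel.
\<close>

section \<open>Symmetric matrices with a one-dimensional kernel\<close>

text \<open>
  The fundamental theorem of algebra supplies a complex root, which is real by assumption and can
  be divided out; the quotient has no new roots.
\<close>

lemma real_rooted_poly_splits:
  fixes p :: "real poly"
  assumes "\<And>z. poly (map_poly complex_of_real p) z = 0 \<Longrightarrow> z \<in> \<real>"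
  shows "\<exists>A. p = Polynomial.smult (lead_coeff p) (\<Prod>a\<in>#A. [:- a, 1:])"
  using assms
proof (induction "degree p" arbitrary: p)
  case 0
  then obtain c where "p = [:c:]" by (metis degree_eq_zeroE)
  then show ?case by (intro exI[of _ "{#}"]) simp
next
  case (Suc n)
  interpret map_poly_hom: map_poly_comm_ring_hom complex_of_real ..
  have "\<not> constant (poly (map_poly complex_of_real p))"
    using Suc.hyps(2) by (simp add: constant_degree degree_map_poly)
  then obtain z where z: "poly (map_poly complex_of_real p) z = 0"
    using fundamental_theorem_of_algebra by blast
  then obtain a where a: "z = complex_of_real a"
    using Suc.prems by (auto elim: Reals_cases)
  then have "poly p a = 0" using z by simp
  then obtain q where q: "p = [:- a, 1:] * q"
    by (auto simp: poly_eq_0_iff_dvd)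
  have q0: "q \<noteq> 0" using q Suc.hyps(2) by auto
  then have "n = degree q" using Suc.hyps(2) unfolding q by (subst (asm) degree_mult_eq) auto
  moreover have "z \<in> \<real>" if "poly (map_poly complex_of_real q) z = 0" for z
    using that by (intro Suc.prems) (simp add: q map_poly_hom.hom_mult del: mult_pCons_left)
  ultimately obtain A where A: "q = Polynomial.smult (lead_coeff q) (\<Prod>a\<in>#A. [:- a, 1:])"
    using Suc.hyps(1) by blast
  have lead: "lead_coeff p = lead_coeff q"
    by (simp add: q lead_coeff_mult del: mult_pCons_left)
  have "p = [:- a, 1:] * Polynomial.smult (lead_coeff q) (\<Prod>a\<in>#A. [:- a, 1:])"
    using q arg_cong[OF A, of "(*) [:- a, 1:]"] by (rule trans)
  also have "\<dots> = Polynomial.smult (lead_coeff p) (\<Prod>a\<in>#add_mset a A. [:- a, 1:])"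
    unfolding lead by (simp del: mult_pCons_left)
  finally have "p = Polynomial.smult (lead_coeff p) (\<Prod>a\<in>#add_mset a A. [:- a, 1:])" .
  then show ?case by blast
qed

lemma prod_linear_factors_nonzero: "(\<Prod>a\<in>#A. [:- a, 1:]) \<noteq> (0 :: 'a::idom poly)"
  by (induction A) (auto simp del: mult_pCons_left)

lemma proots_prod_linear_factors: "proots (\<Prod>a\<in>#A. [:- a, 1:]) = (A :: 'a::idom multiset)"
proof (induction A)
  case (add a A)
  have "proots ([:- a, 1:] * (\<Prod>a\<in>#A. [:- a, 1:])) = proots [:- a, 1:] + proots (\<Prod>a\<in>#A. [:- a, 1:])"
    by (rule proots_mult) (simp, rule prod_linear_factors_nonzero)
  then show ?case using add by (simp del: mult_pCons_left)
qed simp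

lemma degree_prod_linear_factors: "degree (\<Prod>a\<in>#A. [:- a :: 'a::idom, 1:]) = size A"
proof (induction A)
  case (add a A)
  have "degree ([:- a, 1:] * (\<Prod>a\<in>#A. [:- a, 1:])) = degree [:- a, 1:] + degree (\<Prod>a\<in>#A. [:- a, 1:])"
    by (rule degree_mult_eq) (simp, rule prod_linear_factors_nonzero)
  then show ?case using add by (simp del: mult_pCons_left)
qed simp

lemma mat_mult_vec_index:
  "i < n \<Longrightarrow> dim_vec v = n \<Longrightarrow>
     vec_index (mat n n (\<lambda>(i, j). a i j) *\<^sub>v v) i = (\<Sum>j<n. a i j * vec_index v j)"
  by (simp add: scalar_prod_def atLeast0LessThan)

text \<open>
  Eigenvectors are written as functions on indices, so that the estimates below become plain
  double sums.
\<close>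

lemma root_char_poly_imp_eigenvector:
  fixes a :: "nat \<Rightarrow> nat \<Rightarrow> 'a::field"
  assumes "poly (char_poly (mat n n (\<lambda>(i, j). a i j))) k = 0"
  obtains x where "\<exists>i<n. x i \<noteq> 0" "\<And>i. i < n \<Longrightarrow> (\<Sum>j<n. a i j * x j) = k * x i"
proof -
  let ?A = "mat n n (\<lambda>(i, j). a i j)"
  have "eigenvalue ?A k"
    using assms by (subst eigenvalue_root_char_poly[of _ n]) auto
  then obtain v where v: "v \<in> carrier_vec n" "v \<noteq> 0\<^sub>v n" "?A *\<^sub>v v = k \<cdot>\<^sub>v v"
    by (auto simp: eigenvalue_def eigenvector_def)
  show ?thesis
  proof (rule that[of "vec_index v"])
    show "\<exists>i<n. vec_index v i \<noteq> 0"
      using v(1,2) by (metis carrier_vecD eq_vecI index_zero_vec)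
    show "(\<Sum>j<n. a i j * vec_index v j) = k * vec_index v i" if "i < n" for i
      using mat_mult_vec_index[of i n v a] v that by (metis carrier_vecD index_smult_vec(1))
  qed
qed

lemma eigenvector_imp_root_char_poly:
  fixes a :: "nat \<Rightarrow> nat \<Rightarrow> 'a::field"
  assumes "\<exists>i<n. x i \<noteq> 0" "\<And>i. i < n \<Longrightarrow> (\<Sum>j<n. a i j * x j) = k * x i"
  shows "poly (char_poly (mat n n (\<lambda>(i, j). a i j))) k = 0"
proof -
  let ?A = "mat n n (\<lambda>(i, j). a i j)"
  have "?A *\<^sub>v vec n x = k \<cdot>\<^sub>v vec n x"
    by (rule eq_vecI) (use assms(2) in \<open>auto simp: mat_mult_vec_index simp del: index_mult_mat_vec\<close>)
  moreover have "vec n x \<noteq> 0\<^sub>v n"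
    using assms(1) by (metis index_vec index_zero_vec(1))
  ultimately have "eigenvalue ?A k"
    unfolding eigenvalue_def eigenvector_def by (intro exI[of _ "vec n x"]) simp
  then show ?thesis
    by (subst (asm) eigenvalue_root_char_poly[of _ n]) auto
qed

text \<open>
  This turns an algebraic multiplicity of at least two into vectors.  Triangularize the matrix with
  \<open>k\<close> in the first two diagonal places, \<open>A P = P B\<close>.  The first two columns of \<open>P\<close>
  are the vectors \<open>x\<close> and \<open>y\<close>, and \<open>b\<close> is the entry of \<open>B\<close> above the diagonal; they
  are independent because \<open>P\<close> is invertible.
\<close>

lemma repeated_root_char_poly_imp_chain:
  fixes a :: "nat \<Rightarrow> nat \<Rightarrow> real"
  assumes "char_poly (mat n n (\<lambda>(i, j). a i j)) = (\<Prod>e\<in>#add_mset k (add_mset k A). [:- e, 1:])"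
  obtains x y b where
    "\<And>i. i < n \<Longrightarrow> (\<Sum>j<n. a i j * x j) = k * x i"
    "\<And>i. i < n \<Longrightarrow> (\<Sum>j<n. a i j * y j) = b * x i + k * y i"
    "\<And>s t. (\<And>i. i < n \<Longrightarrow> s * x i + t * y i = 0) \<Longrightarrow> s = 0 \<and> t = 0"
proof -
  let ?A = "mat n n (\<lambda>(i, j). a i j)"
  have A: "?A \<in> carrier_mat n n" by simp
  obtain es where es: "mset es = A" by (metis ex_mset)
  obtain B P Q where sd: "schur_decomposition ?A (k # k # es) = (B, P, Q)"
    by (metis prod_cases3)
  have cp: "char_poly ?A = (\<Prod>e\<leftarrow>k # k # es. [:- e, 1:])"
    unfolding assms es[symmetric] prod_mset_prod_list[symmetric] by simp
  from schur_decomposition[OF A cp sd]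
  have wit: "similar_mat_wit ?A B P Q" and ut: "upper_triangular B" and diag: "diag_mat B = k # k # es"
    by auto
  note w = similar_mat_witD2[OF A wit]
  have dimB: "dim_row B = n" "dim_col B = n" and dimP: "dim_row P = n" "dim_col P = n"
    using w by auto
  have n: "n = Suc (Suc (length es))"
    using arg_cong[OF diag, of length] dimB by (simp add: diag_mat_def)
  have B00: "B $$ (0, 0) = k" and B11: "B $$ (1, 1) = k"
    using arg_cong[OF diag, of "\<lambda>l. l ! 0"] arg_cong[OF diag, of "\<lambda>l. l ! 1"] dimB n
    by (auto simp: diag_mat_def simp del: upt_Suc)
  have B0: "B $$ (i, 0) = 0" if "0 < i" "i < n" for i
    using upper_triangularD[OF ut, of 0 i] that dimB by simp
  have B1: "B $$ (i, 1) = 0" if "1 < i" "i < n" for i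
    using upper_triangularD[OF ut, of 1 i] that dimB by simp
  have AP: "?A * P = P * B"
  proof -
    have "?A * P = P * B * (Q * P)"
      using w by (metis assoc_mult_mat mult_carrier_mat)
    then show ?thesis using w by simp
  qed
  have ent: "(\<Sum>j<n. a i j * P $$ (j, l)) = (\<Sum>j<n. P $$ (i, j) * B $$ (j, l))"
    if "i < n" "l < n" for i l
    using arg_cong[OF AP, of "\<lambda>M. M $$ (i, l)"] that dimB dimP
    by (simp add: scalar_prod_def atLeast0LessThan)
  show ?thesis
  proof (rule that[of "\<lambda>i. P $$ (i, 0)" "\<lambda>i. P $$ (i, 1)" "B $$ (0, 1)"])
    show "(\<Sum>j<n. a i j * P $$ (j, 0)) = k * P $$ (i, 0)" if "i < n" for i
    proof -
      have "(\<Sum>j<n. P $$ (i, j) * B $$ (j, 0)) = (\<Sum>j\<in>{0}. P $$ (i, j) * B $$ (j, 0))"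
        by (rule sum.mono_neutral_right) (use n B0 in auto)
      then show ?thesis using ent[of i 0] that n B00 by simp
    qed
    show "(\<Sum>j<n. a i j * P $$ (j, 1)) = B $$ (0, 1) * P $$ (i, 0) + k * P $$ (i, 1)" if "i < n" for i
    proof -
      have "(\<Sum>j<n. P $$ (i, j) * B $$ (j, 1)) = (\<Sum>j\<in>{0, 1}. P $$ (i, j) * B $$ (j, 1))"
      proof (rule sum.mono_neutral_right)
        show "\<forall>j\<in>{..<n} - {0, 1}. P $$ (i, j) * B $$ (j, 1) = 0" using B1 by auto
      qed (use n in auto)
      then show ?thesis using ent[of i 1] that n B11 by simp
    qed
    show "s = 0 \<and> t = 0" if st: "\<And>i. i < n \<Longrightarrow> s * P $$ (i, 0) + t * P $$ (i, 1) = 0" for s t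
    proof -
      have QP: "(\<Sum>j<n. Q $$ (l, j) * P $$ (j, m)) = (if l = m then 1 else 0)"
        if "l < n" "m < n" for l m
        using arg_cong[OF w(2), of "\<lambda>M. M $$ (l, m)"] that dimP w(7)
        by (simp add: scalar_prod_def atLeast0LessThan)
      have "s * (\<Sum>j<n. Q $$ (l, j) * P $$ (j, 0)) + t * (\<Sum>j<n. Q $$ (l, j) * P $$ (j, 1))
          = (\<Sum>j<n. Q $$ (l, j) * (s * P $$ (j, 0) + t * P $$ (j, 1)))" for l
        by (simp add: sum_distrib_left sum.distrib algebra_simps)
      also have "\<dots> l = 0" for l using st by simp
      finally have comb: "s * (\<Sum>j<n. Q $$ (l, j) * P $$ (j, 0)) + t * (\<Sum>j<n. Q $$ (l, j) * P $$ (j, 1)) = 0" for l .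
      have "0 < n" "1 < n" using n by simp_all
      then show ?thesis using comb[of 0] comb[of 1] by (simp add: QP)
    qed
  qed
qed

lemma symmetric_bilinear_swap:
  fixes a :: "nat \<Rightarrow> nat \<Rightarrow> 'a::comm_semiring_0"
  assumes "\<And>i j. i < n \<Longrightarrow> j < n \<Longrightarrow> a i j = a j i"
  shows "(\<Sum>i<n. x i * (\<Sum>j<n. a i j * y j)) = (\<Sum>i<n. y i * (\<Sum>j<n. a i j * x j))"
proof -
  have "(\<Sum>i<n. x i * (\<Sum>j<n. a i j * y j)) = (\<Sum>j<n. \<Sum>i<n. x i * (a i j * y j))"
    by (subst sum.swap) (simp add: sum_distrib_left)
  also have "\<dots> = (\<Sum>j<n. y j * (\<Sum>i<n. a j i * x i))"
    using assms by (auto simp: sum_distrib_left mult_ac intro!: sum.cong)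
  finally show ?thesis .
qed

lemma sum_squares_pos:
  fixes x :: "nat \<Rightarrow> real"
  assumes "\<exists>i<n. x i \<noteq> 0"
  shows "(\<Sum>i<n. x i * x i) > 0"
proof -
  obtain i where "i < n" "x i \<noteq> 0" using assms by blast
  then show ?thesis by (intro sum_pos2[of _ i]) (auto simp: zero_less_mult_iff)
qed

text \<open>
  Let \<open>x + \<i> y\<close> be an eigenvector for \<open>z\<close>.  Evaluating the symmetric form at \<open>x\<close> and \<open>y\<close> in
  both orders gives \<open>Im z * (\<bar>x\<bar>\<^sup>2 + \<bar>y\<bar>\<^sup>2) = 0\<close>.
\<close>

lemma symmetric_char_poly_roots_real:
  fixes a :: "nat \<Rightarrow> nat \<Rightarrow> real"
  assumes sym: "\<And>i j. i < n \<Longrightarrow> j < n \<Longrightarrow> a i j = a j i"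
    and root: "poly (map_poly complex_of_real (char_poly (mat n n (\<lambda>(i, j). a i j)))) z = 0"
  shows "z \<in> \<real>"
proof -
  have "map_mat complex_of_real (mat n n (\<lambda>(i, j). a i j)) =
      mat n n (\<lambda>(i, j). complex_of_real (a i j))"
    by (rule eq_matI) auto
  moreover have "char_poly (map_mat complex_of_real (mat n n (\<lambda>(i, j). a i j))) =
      map_poly complex_of_real (char_poly (mat n n (\<lambda>(i, j). a i j)))"
    by (rule of_real_hom.char_poly_hom[of _ n]) simp
  ultimately have "poly (char_poly (mat n n (\<lambda>(i, j). complex_of_real (a i j)))) z = 0"
    using root by simp
  then obtain v where v: "\<exists>i<n. v i \<noteq> 0"
    "\<And>i. i < n \<Longrightarrow> (\<Sum>j<n. complex_of_real (a i j) * v j) = z * v i"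
    by (rule root_char_poly_imp_eigenvector) blast
  define x y where "x i = Re (v i)" and "y i = Im (v i)" for i
  have x: "(\<Sum>j<n. a i j * x j) = Re z * x i - Im z * y i"
    and y: "(\<Sum>j<n. a i j * y j) = Re z * y i + Im z * x i" if "i < n" for i
    using arg_cong[OF v(2)[OF that], of Re] arg_cong[OF v(2)[OF that], of Im]
    by (simp_all add: x_def y_def)
  have "(\<Sum>i<n. x i * (Re z * y i + Im z * x i)) = (\<Sum>i<n. y i * (Re z * x i - Im z * y i))"
    using symmetric_bilinear_swap[where n = n and a = a and x = x and y = y] sym x y by simp
  then have "Im z * (\<Sum>i<n. x i * x i + y i * y i) = 0"
    by (simp add: sum_distrib_left sum.distrib sum_subtractf algebra_simps)
  moreover have "(\<Sum>i<n. x i * x i + y i * y i) > 0"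
  proof -
    obtain i where i: "i < n" "v i \<noteq> 0" using v(1) by blast
    then have "x i * x i + y i * y i > 0"
      by (simp add: x_def y_def complex_eq_iff sum_squares_gt_zero_iff)
    then show ?thesis using i by (intro sum_pos2[of _ i]) auto
  qed
  ultimately have "Im z = 0" by simp
  then show ?thesis by (simp add: complex_is_Real_iff)
qed

text \<open>
  All \<open>n\<close> roots of the characteristic polynomial are real, and semidefiniteness makes them
  nonpositive.  It remains to see that \<open>0\<close> has algebraic, not just geometric, multiplicity one.
  Otherwise there are independent \<open>x\<close>, \<open>y\<close> with \<open>A x = 0\<close> and \<open>A y = b x\<close>.  By symmetry
  \<open>b \<bar>x\<bar>\<^sup>2 = x \<cdot> A y = y \<cdot> A x = 0\<close>, so \<open>y\<close> lies in the kernel as well, which is only a line.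
\<close>

lemma neg_semidefinite_simple_kernel_spectrum:
  fixes a :: "nat \<Rightarrow> nat \<Rightarrow> real"
  assumes sym: "\<And>i j. i < n \<Longrightarrow> j < n \<Longrightarrow> a i j = a j i"
    and nsd: "\<And>x. (\<Sum>i<n. x i * (\<Sum>j<n. a i j * x j)) \<le> 0"
    and u: "\<exists>i<n. u i \<noteq> 0" "\<And>i. i < n \<Longrightarrow> (\<Sum>j<n. a i j * u j) = 0"
    and ker: "\<And>x. (\<And>i. i < n \<Longrightarrow> (\<Sum>j<n. a i j * x j) = 0) \<Longrightarrow> \<exists>c. \<forall>i<n. x i = c * u i"
  shows "Suc (size {#x \<in># proots (char_poly (mat n n (\<lambda>(i, j). a i j))). x < 0#}) = n"
proof -
  let ?p = "char_poly (mat n n (\<lambda>(i, j). a i j))"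
  have monic: "degree ?p = n" "lead_coeff ?p = 1"
    using degree_monic_char_poly[of "mat n n (\<lambda>(i, j). a i j)" n] by auto
  have "z \<in> \<real>" if "poly (map_poly complex_of_real ?p) z = 0" for z
    using sym that by (rule symmetric_char_poly_roots_real)
  then obtain A where A: "?p = (\<Prod>e\<in>#A. [:- e, 1:])"
    using real_rooted_poly_splits[of ?p] monic by auto
  have roots: "proots ?p = A" unfolding A by (rule proots_prod_linear_factors)
  have sz: "size A = n"
    using monic(1) by (simp add: A degree_prod_linear_factors)
  have p0: "?p \<noteq> 0" using monic(2) by auto
  have mem: "e \<in># A \<longleftrightarrow> poly ?p e = 0" for e
    using set_count_proots[OF p0] unfolding roots by simp
  have nonpos: "e \<le> 0" if "e \<in># A" for e
  proof -
    have "poly ?p e = 0" using that mem by simp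
    then obtain x where x: "\<exists>i<n. x i \<noteq> 0" "\<And>i. i < n \<Longrightarrow> (\<Sum>j<n. a i j * x j) = e * x i"
      by (rule root_char_poly_imp_eigenvector) blast
    have "e * (\<Sum>i<n. x i * x i) = (\<Sum>i<n. x i * (\<Sum>j<n. a i j * x j))"
      using x(2) by (simp add: sum_distrib_left mult_ac)
    also have "\<dots> \<le> 0" by (rule nsd)
    finally show ?thesis using sum_squares_pos[OF x(1)] by (simp add: mult_le_0_iff)
  qed
  have "poly ?p 0 = 0"
    by (rule eigenvector_imp_root_char_poly[OF u(1)]) (use u(2) in auto)
  then have "0 \<in># A" using mem by simp
  then obtain A' where A': "A = add_mset 0 A'" by (metis insert_DiffM)
  have "0 \<notin># A'"
  proof
    assume "0 \<in># A'"
    then obtain A'' where "A' = add_mset 0 A''" by (metis insert_DiffM)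
    with A A' have "?p = (\<Prod>e\<in>#add_mset 0 (add_mset 0 A''). [:- e, 1:])" by simp
    then obtain x y b where
      x: "\<And>i. i < n \<Longrightarrow> (\<Sum>j<n. a i j * x j) = 0 * x i" and
      y: "\<And>i. i < n \<Longrightarrow> (\<Sum>j<n. a i j * y j) = b * x i + 0 * y i" and
      ind: "\<And>s t. (\<And>i. i < n \<Longrightarrow> s * x i + t * y i = 0) \<Longrightarrow> s = 0 \<and> t = 0"
      by (rule repeated_root_char_poly_imp_chain) blast
    have xn0: "\<exists>i<n. x i \<noteq> 0"
      using ind[of 1 0] by auto
    have "b * (\<Sum>i<n. x i * x i) = (\<Sum>i<n. x i * (\<Sum>j<n. a i j * y j))"
      using y by (simp add: sum_distrib_left mult_ac)
    also have "\<dots> = (\<Sum>i<n. y i * (\<Sum>j<n. a i j * x j))"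
      by (rule symmetric_bilinear_swap[OF sym])
    also have "\<dots> = 0" using x by simp
    finally have "b = 0" using sum_squares_pos[OF xn0] by simp
    then obtain c d where c: "\<forall>i<n. x i = c * u i" and d: "\<forall>i<n. y i = d * u i"
      using ker[of x] ker[of y] x y by auto
    have "d = 0 \<and> - c = 0"
      by (rule ind) (use c d in auto)
    then show False using c xn0 by auto
  qed
  have "x < 0" if "x \<in># A'" for x
  proof -
    have "x \<noteq> 0" using that \<open>0 \<notin># A'\<close> by metis
    moreover have "x \<le> 0" using that A' by (intro nonpos) simp
    ultimately show ?thesis by simp
  qed
  then have "filter_mset (\<lambda>x. x < 0) A' = A'"
    by (simp add: filter_mset_eq_conv)
  then show ?thesis unfolding roots using sz by (simp add: A')
qed

section \<open>Weighted graph Laplacians\<close>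

lemma laplacian_apply:
  fixes w :: "nat \<Rightarrow> nat \<Rightarrow> real"
  assumes "i < n"
  shows "(\<Sum>j<n. (w i j - (if i = j then \<Sum>k<n. w i k else 0)) * x j) = (\<Sum>j<n. w i j * (x j - x i))"
proof -
  have "(\<Sum>j<n. (w i j - (if i = j then \<Sum>k<n. w i k else 0)) * x j)
      = (\<Sum>j<n. w i j * x j) - (\<Sum>j<n. if i = j then (\<Sum>k<n. w i k) * x j else 0)"
    by (simp add: left_diff_distrib sum_subtractf if_distrib[of "\<lambda>t. t * _"] cong: if_cong)
  also have "\<dots> = (\<Sum>j<n. w i j * x j) - (\<Sum>k<n. w i k) * x i"
    using assms by simp
  also have "\<dots> = (\<Sum>j<n. w i j * (x j - x i))"
    by (simp add: right_diff_distrib sum_subtractf sum_distrib_right)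
  finally show ?thesis .
qed

text \<open>
  Averaging the sum with the one in which \<open>i\<close> and \<open>j\<close> are exchanged produces the squares.
\<close>

lemma laplacian_quadratic_form:
  fixes w :: "nat \<Rightarrow> nat \<Rightarrow> real"
  assumes "\<And>i j. i < n \<Longrightarrow> j < n \<Longrightarrow> w i j = w j i"
  shows "(\<Sum>i<n. x i * (\<Sum>j<n. w i j * (x j - x i))) = - (\<Sum>i<n. \<Sum>j<n. w i j * (x i - x j)\<^sup>2) / 2"
proof -
  let ?T = "\<Sum>i<n. x i * (\<Sum>j<n. w i j * (x j - x i))"
  have "?T = (\<Sum>i<n. \<Sum>j<n. w i j * x i * (x j - x i))"
    by (simp add: sum_distrib_left mult_ac)
  moreover have "\<dots> = (\<Sum>i<n. \<Sum>j<n. w i j * x j * (x i - x j))"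
    by (subst sum.swap) (use assms in \<open>auto intro!: sum.cong\<close>)
  ultimately have "2 * ?T = (\<Sum>i<n. \<Sum>j<n. w i j * x i * (x j - x i) + w i j * x j * (x i - x j))"
    by (simp add: sum.distrib)
  also have "\<dots> = (\<Sum>i<n. \<Sum>j<n. - (w i j * (x i - x j)\<^sup>2))"
    by (intro sum.cong refl) (simp add: power2_eq_square algebra_simps)
  finally show ?thesis by (simp add: sum_negf)
qed

text \<open>
  The matrix is the negated Laplacian of the weights \<open>w\<close>.  Connectedness is stated in the form in
  which it is used: a vector that agrees across every edge of positive weight is constant.  By the
  sum-of-squares formula this says exactly that the kernel consists of the constant vectors.
\<close>

lemma connected_laplacian_spectrum:
  fixes w :: "nat \<Rightarrow> nat \<Rightarrow> real"
  assumes "n > 0"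
    and sym: "\<And>i j. i < n \<Longrightarrow> j < n \<Longrightarrow> w i j = w j i"
    and nonneg: "\<And>i j. i < n \<Longrightarrow> j < n \<Longrightarrow> w i j \<ge> 0"
    and conn: "\<And>x :: nat \<Rightarrow> real. (\<And>i j. i < n \<Longrightarrow> j < n \<Longrightarrow> w i j > 0 \<Longrightarrow> x i = x j) \<Longrightarrow>
                 \<forall>i<n. x i = x 0"
  shows "Suc (size {#x \<in># proots (char_poly
           (mat n n (\<lambda>(i, j). w i j - (if i = j then \<Sum>k<n. w i k else 0)))). x < 0#}) = n"
proof (rule neg_semidefinite_simple_kernel_spectrum[where u = "\<lambda>_. 1"])
  have form: "(\<Sum>i<n. x i * (\<Sum>j<n. (w i j - (if i = j then \<Sum>k<n. w i k else 0)) * x j))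
      = - (\<Sum>i<n. \<Sum>j<n. w i j * (x i - x j)\<^sup>2) / 2" for x
    using laplacian_quadratic_form[of n w, OF sym] by (simp add: laplacian_apply)
  have terms: "w i j * (x i - x j)\<^sup>2 \<ge> 0" if "i < n" "j < n" for x i j
    using nonneg that by simp
  show "(\<Sum>i<n. x i * (\<Sum>j<n. (w i j - (if i = j then \<Sum>k<n. w i k else 0)) * x j)) \<le> 0" for x
    unfolding form by (auto intro!: sum_nonneg terms)
  show "\<exists>c. \<forall>i<n. x i = c * 1"
    if "\<And>i. i < n \<Longrightarrow> (\<Sum>j<n. (w i j - (if i = j then \<Sum>k<n. w i k else 0)) * x j) = 0" for x
  proof -
    have "(\<Sum>i<n. \<Sum>j<n. w i j * (x i - x j)\<^sup>2) = 0"
      using form[of x] that by simp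
    then have "(\<Sum>j<n. w i j * (x i - x j)\<^sup>2) = 0" if "i < n" for i
      by (rule sum_nonneg_0[rotated 2]) (use that in \<open>auto intro!: sum_nonneg terms\<close>)
    then have "w i j * (x i - x j)\<^sup>2 = 0" if "i < n" "j < n" for i j
      by (rule sum_nonneg_0[rotated 2]) (use that in \<open>auto intro!: terms\<close>)
    then have "\<forall>i<n. x i = x 0" by (intro conn) force
    then show ?thesis unfolding mult_1_right by (rule exI)
  qed
  show "(\<Sum>j<n. (w i j - (if i = j then \<Sum>k<n. w i k else 0)) * 1) = 0" if "i < n" for i
    using laplacian_apply[OF that, of w "\<lambda>_. 1"] by simp
qed (use \<open>n > 0\<close> sym in auto)

section \<open>Linear stability of equilibria with small angle differences\<close>

lemma sum_neighbours_nth: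
  assumes "distinct vs" "neighbours H v \<subseteq> set vs"
  shows "(\<Sum>u\<in>neighbours H v. g u) = (\<Sum>k<length vs. if (v, vs ! k) \<in> parcs H then g (vs ! k) else 0)"
proof -
  have "(\<Sum>u\<in>neighbours H v. g u) = (\<Sum>u\<in>set vs. if (v, u) \<in> parcs H then g u else 0)"
    using assms(2) by (intro sum.mono_neutral_cong_left) (auto simp: neighbours_def)
  then show ?thesis
    by (simp add: sum.reindex_bij_betw[OF bij_betw_nth[OF assms(1) refl refl], symmetric])
qed

text \<open>
  Differentiating \<open>sin (\<theta> x - \<theta> v)\<close> in the variable \<open>\<theta> u\<close> gives
  \<open>cos (\<theta> x - \<theta> v)\<close> times \<open>[x = u] - [v = u]\<close>.  The first bracket contributes the
  off-diagonal weights, the second one the diagonal.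
\<close>

lemma kuramoto_jacobian_eq_laplacian:
  fixes H :: "'a pair_pre_digraph" and \<theta> :: "'a \<Rightarrow> real"
  assumes vs: "distinct vs" "\<And>i. i < length vs \<Longrightarrow> neighbours H (vs ! i) \<subseteq> set vs"
  defines "w \<equiv> \<lambda>i j. if (vs ! i, vs ! j) \<in> parcs H then cos (\<theta> (vs ! j) - \<theta> (vs ! i)) else 0"
  shows "kuramoto_jacobian H vs \<theta> = mat (length vs) (length vs)
           (\<lambda>(i, j). w i j - (if i = j then \<Sum>k<length vs. w i k else 0))"
proof (rule eq_matI)
  fix i j assume "i < dim_row (mat (length vs) (length vs)
           (\<lambda>(i, j). w i j - (if i = j then \<Sum>k<length vs. w i k else 0)))"
    and "j < dim_col (mat (length vs) (length vs)
           (\<lambda>(i, j). w i j - (if i = j then \<Sum>k<length vs. w i k else 0)))"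
  then have i: "i < length vs" and j: "j < length vs" by auto
  let ?v = "vs ! i" and ?u = "vs ! j"
  let ?ind = "\<lambda>x. if x = ?u then 1 else 0 :: real"
  have upd: "((\<lambda>t. (\<theta>(?u := t)) x) has_real_derivative ?ind x) (at t)" for x t
    by (cases "x = ?u") auto
  have "((\<lambda>t. kuramoto H (\<theta>(?u := t)) ?v) has_real_derivative
     (\<Sum>x\<in>neighbours H ?v. cos ((\<theta>(?u := \<theta> ?u)) x - (\<theta>(?u := \<theta> ?u)) ?v) * (?ind x - ?ind ?v)))
     (at (\<theta> ?u))"
    unfolding kuramoto_def
    by (intro DERIV_sum DERIV_fun_sin DERIV_diff upd)
  then have "deriv (\<lambda>t. kuramoto H (\<theta>(?u := t)) ?v) (\<theta> ?u) =
     (\<Sum>x\<in>neighbours H ?v. cos (\<theta> x - \<theta> ?v) * (?ind x - ?ind ?v))"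
    by (simp add: DERIV_imp_deriv)
  also have "\<dots> = (\<Sum>k<length vs. w i k * ((if k = j then 1 else 0) - (if i = j then 1 else 0)))"
    unfolding sum_neighbours_nth[OF vs(1) vs(2)[OF i]] using vs(1) i j
    by (intro sum.cong) (auto simp: w_def nth_eq_iff_index_eq)
  also have "\<dots> = w i j - (if i = j then \<Sum>k<length vs. w i k else 0)"
    using j by (simp add: right_diff_distrib sum_subtractf if_distrib[of "\<lambda>t. _ * t"] cong: if_cong)
  finally show "kuramoto_jacobian H vs \<theta> $$ (i, j) = mat (length vs) (length vs)
           (\<lambda>(i, j). w i j - (if i = j then \<Sum>k<length vs. w i k else 0)) $$ (i, j)"
    using i j by (simp add: kuramoto_jacobian_def)
qed (simp_all add: kuramoto_jacobian_def)

text \<open>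
  Where neighbouring angles differ by less than a right angle modulo \<open>2 * pi\<close>, the Jacobian is the negated Laplacian
  of positive weights on a connected graph.
\<close>

lemma linearly_stable_if_cos_pos:
  fixes H :: "'a pair_pre_digraph" and \<theta> :: "'a \<Rightarrow> real"
  assumes arcs: "parcs H \<subseteq> pverts H \<times> pverts H" and sym: "sym (parcs H)"
    and r: "r \<in> pverts H"
    and conn: "\<And>x :: 'a \<Rightarrow> real. (\<And>u v. (u, v) \<in> parcs H \<Longrightarrow> x u = x v) \<Longrightarrow> \<forall>v\<in>pverts H. x v = x r"
    and pos: "\<And>u v. (u, v) \<in> parcs H \<Longrightarrow> cos (\<theta> v - \<theta> u) > 0"
  shows "linearly_stable H \<theta>"
  unfolding linearly_stable_def
proof (intro allI impI, elim conjE)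
  fix vs :: "'a list" assume vs: "distinct vs" "set vs = pverts H"
  let ?w = "\<lambda>i j. if (vs ! i, vs ! j) \<in> parcs H then cos (\<theta> (vs ! j) - \<theta> (vs ! i)) else 0"
  have "neighbours H v \<subseteq> set vs" for v
    using arcs vs by (auto simp: neighbours_def)
  note jac = kuramoto_jacobian_eq_laplacian[OF vs(1) this]
  show "Suc (size {#x \<in># proots (char_poly (kuramoto_jacobian H vs \<theta>)). x < 0#}) = length vs"
    unfolding jac
  proof (rule connected_laplacian_spectrum)
    show "0 < length vs" using r vs(2) by auto
    show "?w i j = ?w j i" for i j
      using sym cos_minus[of "\<theta> (vs ! j) - \<theta> (vs ! i)"] by (auto dest: symD)
    show "0 \<le> ?w i j" for i j using pos by (auto intro: less_imp_le)
    fix x :: "nat \<Rightarrow> real"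
    assume x: "\<And>i j. i < length vs \<Longrightarrow> j < length vs \<Longrightarrow> 0 < ?w i j \<Longrightarrow> x i = x j"
    \<comment> \<open>Transport \<open>x\<close> from indices to vertices, where connectedness is assumed.\<close>
    define y where "y v = x (THE i. i < length vs \<and> vs ! i = v)" for v
    have y: "y (vs ! i) = x i" if "i < length vs" for i
    proof -
      have "(THE k. k < length vs \<and> vs ! k = vs ! i) = i"
        using that vs(1) by (auto simp: nth_eq_iff_index_eq)
      then show ?thesis by (simp add: y_def)
    qed
    have "\<forall>v\<in>pverts H. y v = y r"
    proof (rule conn)
      fix u v assume uv: "(u, v) \<in> parcs H"
      then obtain i j where "i < length vs" "u = vs ! i" "j < length vs" "v = vs ! j"
        using arcs vs(2) by (metis in_set_conv_nth mem_Sigma_iff subsetD)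
      then show "y u = y v" using x[of i j] y uv pos by auto
    qed
    then show "\<forall>i<length vs. x i = x 0"
      using y vs(2) by (metis gr_zeroI less_nat_zero_code nth_mem)
  qed
qed

section \<open>The five-cycle joined to a graph along an edge\<close>

lemma cycle_graph_rotate: "cycle_graph (rotate k vs) = cycle_graph vs"
proof (cases "vs = []")
  case False
  define n where "n = length vs"
  have n: "n > 0" using False by (simp add: n_def)
  define F where "F i = {(vs ! i, vs ! (Suc i mod n)), (vs ! (Suc i mod n), vs ! i)}" for i
  have "{..<n} \<subseteq> (\<lambda>i. (k + i) mod n) ` {..<n}"
  proof
    fix j assume "j \<in> {..<n}"
    then have j: "j < n" by simp
    have "(k + (n - k mod n + j) mod n) mod n = (k mod n + (n - k mod n + j)) mod n"
      by (simp only: mod_add_left_eq mod_add_right_eq)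
    also have "k mod n + (n - k mod n + j) = n + j"
      using mod_less_divisor[OF n, of k] by linarith
    finally have "(k + (n - k mod n + j) mod n) mod n = j" using j by simp
    then show "j \<in> (\<lambda>i. (k + i) mod n) ` {..<n}"
      using n by (intro image_eqI[of _ _ "(n - k mod n + j) mod n"]) auto
  qed
  then have shift: "(\<lambda>i. (k + i) mod n) ` {..<n} = {..<n}"
    using n by auto
  have nth: "rotate k vs ! i = vs ! ((k + i) mod n)" if "i < n" for i
    using that by (simp add: nth_rotate n_def)
  have "parcs (cycle_graph (rotate k vs)) = (\<Union>i<n. F ((k + i) mod n))"
    using n by (auto simp: cycle_graph_def Let_def F_def nth mod_simps simp flip: n_def)
  also have "\<dots> = (\<Union>i\<in>(\<lambda>i. (k + i) mod n) ` {..<n}. F i)"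
    by simp
  also have "\<dots> = parcs (cycle_graph vs)"
    unfolding shift by (simp add: cycle_graph_def Let_def F_def n_def)
  finally show ?thesis by (simp add: cycle_graph_def Let_def)
qed simp

text \<open>
  Rotating the enumeration lets the distinguished edge join the first two vertices.  Its orientation
  is forgotten, since joining depends only on the set of endpoints.
\<close>

lemma five_cycle_edge_first:
  fixes C :: "'a pair_pre_digraph"
  assumes "is_cycle_graph 5 C" "e \<in> parcs C"
  obtains a b c d f where "distinct [a, b, c, d, f]" "{fst e, snd e} = {a, b}"
    "C = cycle_graph [a, b, c, d, f]"
proof -
  obtain vs where vs: "distinct vs" "length vs = 5" "C = cycle_graph vs"
    using assms(1) by (auto simp: is_cycle_graph_def)
  then obtain k where k: "k < 5" "{fst e, snd e} = {vs ! k, vs ! (Suc k mod 5)}"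
    using assms(2) by (auto simp: cycle_graph_def Let_def insert_commute)
  have "\<exists>a b c d f. us = [a, b, c, d, f]" if "length us = 5" for us :: "'a list"
    using that by (auto simp: numeral_eq_Suc length_Suc_conv)
  then obtain a b c d f where us: "rotate k vs = [a, b, c, d, f]"
    using vs(2) by (metis length_rotate)
  have nth: "rotate k vs ! i = vs ! ((k + i) mod 5)" if "i < 5" for i
    using that vs(2) by (simp add: nth_rotate)
  show ?thesis
  proof (rule that[of a b c d f])
    show "distinct [a, b, c, d, f]" using vs(1) us by (metis distinct_rotate)
    show "{fst e, snd e} = {a, b}" using k nth[of 0] nth[of 1] us by simp
    show "C = cycle_graph [a, b, c, d, f]" using cycle_graph_rotate[of k vs] us vs(3) by simp
  qed
qed

lemma cycle_graph_five:
  "cycle_graph [a, b, c, d, f] = \<lparr>pverts = {a, b, c, d, f},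
     parcs = {(a, b), (b, a), (b, c), (c, b), (c, d), (d, c), (d, f), (f, d), (f, a), (a, f)}\<rparr>"
proof -
  have len: "length [a, b, c, d, f] = 5" by simp
  have less: "{..<5 :: nat} = {0, 1, 2, 3, 4}" by auto
  show ?thesis
    unfolding cycle_graph_def Let_def len less by (simp add: insert_commute)
qed

text \<open>
  At \<open>s = 0\<close> the left side vanishes and the right side is \<open>1\<close>.  At \<open>s = pi / 5\<close>, the regular
  twisted state of the bare five-cycle, \<open>sin (2 * s)\<close> equals the right side, so the nonnegative term
  \<open>d * sin s\<close> makes the left side at least as large.  The intermediate value theorem applies.
\<close>

lemma ex_half_angle:
  fixes d :: real
  assumes "d \<ge> 0"
  shows "\<exists>s. 0 < s \<and> s \<le> pi / 5 \<and> sin (2 * s) + d * sin s = cos (s / 2)"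
proof -
  let ?f = "\<lambda>s :: real. sin (2 * s) + d * sin s - cos (s / 2)"
  have "sin (2 * (pi / 5)) = cos (pi / 5 / 2)"
    by (simp add: sin_cos_eq)
  moreover have "sin (pi / 5) \<ge> 0" by (intro sin_ge_zero) auto
  ultimately have "?f (pi / 5) \<ge> 0" using assms by simp
  then obtain s where s: "0 \<le> s" "s \<le> pi / 5" "?f s = 0"
    using IVT'[of ?f 0 0 "pi / 5"] by (force intro!: continuous_intros)
  moreover have "s \<noteq> 0" using s(3) by auto
  ultimately show ?thesis by (intro exI[of _ s]) auto
qed

lemma join_to_edge_five_cycle:
  assumes "{fst e, snd e} = {a, b}"
  shows "pverts (join_to_edge (cycle_graph [a, b, c, d, f]) e G) = {a, b, c, d, f} \<union> pverts G"
    and "parcs (join_to_edge (cycle_graph [a, b, c, d, f]) e G) =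
      {(a, b), (b, a), (b, c), (c, b), (c, d), (d, c), (d, f), (f, d), (f, a), (a, f)}
      \<union> parcs G \<union> {a, b} \<times> pverts G \<union> pverts G \<times> {a, b}"
  by (simp_all add: join_to_edge_def cycle_graph_five assms)

text \<open>
  A symmetric relation holds along every edge as soon as it holds for one orientation of each; this
  is used for the cosines, for the end vertices and for the symmetry of the arcs.
\<close>

lemma join_to_edge_five_cycle_arc_cases:
  assumes e: "{fst e, snd e} = {a, b}"
    and arc: "(u, v) \<in> parcs (join_to_edge (cycle_graph [a, b, c, d, f]) e G)"
    and sym: "\<And>u v. P u v \<Longrightarrow> P v u"
    and cycle: "P a b" "P b c" "P c d" "P d f" "P f a"
    and G: "\<And>u v. (u, v) \<in> parcs G \<Longrightarrow> P u v"
    and join: "\<And>v. v \<in> pverts G \<Longrightarrow> P a v" "\<And>v. v \<in> pverts G \<Longrightarrow> P b v"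
  shows "P u v"
proof -
  from arc consider
    "(u, v) \<in> {(a, b), (b, a), (b, c), (c, b), (c, d), (d, c), (d, f), (f, d), (f, a), (a, f)}"
    | "(u, v) \<in> parcs G" | "u = a \<or> u = b" "v \<in> pverts G" | "u \<in> pverts G" "v = a \<or> v = b"
    unfolding join_to_edge_five_cycle(2)[OF e] by (elim UnE) simp_all
  then show ?thesis
  proof cases
    case 1
    then show ?thesis by (elim insertE emptyE) (simp_all add: cycle cycle[THEN sym])
  next
    case 2
    then show ?thesis by (rule G)
  next
    case 3
    then show ?thesis using join by metis
  next
    case 4
    then show ?thesis using join sym by metis
  qed
qed

text \<open>
  The witness puts all of \<open>G\<close> at angle \<open>0\<close>, the ends of the edge at \<open>- s\<close> and \<open>s\<close>, and
  continues around the cycle in equal steps \<open>\<beta>\<close>.  The cycle closes after one full turn because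
  \<open>2 * s + 4 * \<beta> = 2 * pi\<close>.
\<close>

lemma join_to_edge_of_five_cycle_exotic:
  fixes G :: "'a pair_pre_digraph"
  assumes "pair_graph G" and dist: "distinct [a, b, c, d, f]"
    and disj: "pverts G \<inter> {a, b, c, d, f} = {}" and e: "{fst e, snd e} = {a, b}"
  shows "\<exists>\<theta>. exotic_solution (join_to_edge (cycle_graph [a, b, c, d, f]) e G) \<theta>"
proof -
  interpret pair_graph G by fact
  have arcs_sym: "(v, u) \<in> parcs G" if "(u, v) \<in> parcs G" for u v
    using pair_sym_arcs that by (simp add: symmetric_def sym_def)
  let ?H = "join_to_edge (cycle_graph [a, b, c, d, f]) e G"
  let ?V = "pverts G"
  have V: "finite ?V" by (rule pair_finite_verts)
  have arcsG: "parcs G \<subseteq> ?V \<times> ?V"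
    using in_arcsD1 in_arcsD2 by auto
  have notV: "a \<notin> ?V" "b \<notin> ?V" "c \<notin> ?V" "d \<notin> ?V" "f \<notin> ?V"
    using disj by auto
  note verts = join_to_edge_five_cycle(1)[OF e, of c d f G]
  note arcs = join_to_edge_five_cycle(2)[OF e, of c d f G]
  note arc_cases = join_to_edge_five_cycle_arc_cases[OF e]
  obtain s where s: "0 < s" "s \<le> pi / 5" "sin (2 * s) + real (card ?V) * sin s = cos (s / 2)"
    using ex_half_angle[of "real (card ?V)"] by auto
  define \<beta> where "\<beta> = (pi - s) / 2"
  have sin\<beta>: "sin \<beta> = cos (s / 2)"
    by (simp add: \<beta>_def diff_divide_distrib sin_diff)
  define \<theta> where "\<theta> = (\<lambda>_. 0)(a := - s, b := s, c := s + \<beta>, d := s + 2 * \<beta>, f := s + 3 * \<beta>)"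
  have \<theta>: "\<theta> a = - s" "\<theta> b = s" "\<theta> c = s + \<beta>" "\<theta> d = s + 2 * \<beta>" "\<theta> f = s + 3 * \<beta>"
    using dist by (auto simp: \<theta>_def)
  have \<theta>V: "\<theta> v = 0" if "v \<in> ?V" for v
    using that notV by (auto simp: \<theta>_def)
  \<comment> \<open>Up to a full turn, the step from \<open>f\<close> to \<open>a\<close> is again \<open>\<beta>\<close>.\<close>
  have wrap: "\<theta> f - \<theta> a = 2 * pi - \<beta>" "\<theta> a - \<theta> f = \<beta> - 2 * pi"
    unfolding \<theta> by (simp_all add: \<beta>_def field_simps)
  have equi: "equilibrium ?H \<theta>"
    unfolding equilibrium_def
  proof
    fix v assume "v \<in> pverts ?H"
    then consider "v = a" | "v = b" | "v = c" | "v = d" | "v = f" | "v \<in> ?V"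
      unfolding verts by auto
    then show "kuramoto ?H \<theta> v = 0"
    proof cases
      case 1
      have "neighbours ?H a = {b, f} \<union> ?V"
        using dist notV arcsG by (auto simp: neighbours_def arcs)
      then have "kuramoto ?H \<theta> a = (\<Sum>w\<in>{b, f}. sin (\<theta> w - \<theta> a)) + (\<Sum>w\<in>?V. sin (\<theta> w - \<theta> a))"
        unfolding kuramoto_def using V notV by (simp only:) (subst sum.union_disjoint, auto)
      also have "(\<Sum>w\<in>?V. sin (\<theta> w - \<theta> a)) = real (card ?V) * sin s"
        by (simp add: \<theta>V \<theta>(1))
      also have "(\<Sum>w\<in>{b, f}. sin (\<theta> w - \<theta> a)) = sin (2 * s) - sin \<beta>"
        using dist wrap(1) \<theta>(1,2) by (simp add: sin_diff)
      finally show ?thesis using s(3) sin\<beta> 1 by simp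
    next
      case 2
      have "neighbours ?H b = {a, c} \<union> ?V"
        using dist notV arcsG by (auto simp: neighbours_def arcs)
      then have "kuramoto ?H \<theta> b = (\<Sum>w\<in>{a, c}. sin (\<theta> w - \<theta> b)) + (\<Sum>w\<in>?V. sin (\<theta> w - \<theta> b))"
        unfolding kuramoto_def using V notV by (simp only:) (subst sum.union_disjoint, auto)
      also have "(\<Sum>w\<in>?V. sin (\<theta> w - \<theta> b)) = - real (card ?V) * sin s"
        by (simp add: \<theta>V \<theta>(2))
      also have "(\<Sum>w\<in>{a, c}. sin (\<theta> w - \<theta> b)) = - sin (2 * s) + sin \<beta>"
        using dist sin_minus[of "2 * s"] by (simp add: \<theta>)
      finally show ?thesis using s(3) sin\<beta> 2 by simp
    next
      case 3
      have "neighbours ?H c = {b, d}"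
        using dist notV arcsG by (auto simp: neighbours_def arcs)
      then show ?thesis using 3 dist by (simp add: kuramoto_def \<theta>)
    next
      case 4
      have "neighbours ?H d = {c, f}"
        using dist notV arcsG by (auto simp: neighbours_def arcs)
      then show ?thesis using 4 dist by (simp add: kuramoto_def \<theta>)
    next
      case 5
      have "neighbours ?H f = {d, a}"
        using dist notV arcsG by (auto simp: neighbours_def arcs)
      moreover have "d \<noteq> a" using dist by auto
      ultimately have "kuramoto ?H \<theta> f = sin (\<theta> d - \<theta> f) + sin (\<theta> a - \<theta> f)"
        by (simp add: kuramoto_def)
      also have "\<dots> = 0" unfolding wrap(2) by (simp add: \<theta> sin_diff)
      finally show ?thesis using 5 by simp
    next
      case 6
      have "neighbours ?H v = {a, b} \<union> neighbours G v"
        using 6 notV by (auto simp: neighbours_def arcs)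
      moreover have NG: "neighbours G v \<subseteq> ?V" using arcsG by (auto simp: neighbours_def)
      ultimately have "kuramoto ?H \<theta> v =
          (\<Sum>w\<in>{a, b}. sin (\<theta> w - \<theta> v)) + (\<Sum>w\<in>neighbours G v. sin (\<theta> w - \<theta> v))"
        unfolding kuramoto_def using finite_subset[OF NG V] notV
        by (simp only:) (subst sum.union_disjoint, auto)
      also have "(\<Sum>w\<in>neighbours G v. sin (\<theta> w - \<theta> v)) = 0"
        using NG \<theta>V 6 by (intro sum.neutral) auto
      also have "(\<Sum>w\<in>{a, b}. sin (\<theta> w - \<theta> v)) = 0"
        using dist \<theta>(1,2) \<theta>V[OF 6] by simp
      finally show ?thesis by simp
    qed
  qed
  have cos_pos: "cos s > 0" "cos (2 * s) > 0"
    using s(1,2) pi_gt_zero by (intro cos_gt_zero; linarith)+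
  have "0 < \<beta>" "\<beta> < pi / 2"
    using s(1,2) pi_gt_zero by (simp_all add: \<beta>_def)
  then have cos\<beta>_pos: "cos \<beta> > 0" by (rule cos_gt_zero)
  have cos_diff_pos: "cos (\<theta> v - \<theta> u) > 0" if "(u, v) \<in> parcs ?H" for u v
    using that
  proof (rule arc_cases)
    show "cos (\<theta> u - \<theta> v) > 0" if "cos (\<theta> v - \<theta> u) > 0" for u v
      using that cos_minus[of "\<theta> u - \<theta> v"] by simp
    show "cos (\<theta> b - \<theta> a) > 0" "cos (\<theta> c - \<theta> b) > 0" "cos (\<theta> d - \<theta> c) > 0" "cos (\<theta> f - \<theta> d) > 0"
      using cos_pos cos\<beta>_pos by (simp_all add: \<theta>)
    show "cos (\<theta> a - \<theta> f) > 0"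
      unfolding wrap(2) using cos\<beta>_pos by (simp add: cos_diff)
    show "cos (\<theta> v - \<theta> u) > 0" if "(u, v) \<in> parcs G" for u v
      using \<theta>V in_arcsD1[OF that] in_arcsD2[OF that] by simp
    show "cos (\<theta> v - \<theta> a) > 0" "cos (\<theta> v - \<theta> b) > 0" if "v \<in> ?V" for v
      using cos_pos(1) by (simp_all add: \<theta>(1,2) \<theta>V[OF that])
  qed
  have arcs_verts: "u \<in> pverts ?H \<and> v \<in> pverts ?H" if "(u, v) \<in> parcs ?H" for u v
    using that by (rule arc_cases) (simp_all add: verts in_arcsD1 in_arcsD2)
  have arcs_sym: "(v, u) \<in> parcs ?H" if "(u, v) \<in> parcs ?H" for u v
  proof -
    have "(u, v) \<in> parcs ?H \<and> (v, u) \<in> parcs ?H"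
      using that
    proof (rule arc_cases)
      show "(x, y) \<in> parcs ?H \<and> (y, x) \<in> parcs ?H" if "(x, y) \<in> parcs G" for x y
        using that pair_sym_arcs by (simp add: arcs symmetric_def symD)
    qed (simp_all add: arcs)
    then show ?thesis ..
  qed
  have stable: "linearly_stable ?H \<theta>"
  proof (rule linearly_stable_if_cos_pos[where r = a])
    show "parcs ?H \<subseteq> pverts ?H \<times> pverts ?H"
      by (intro subrelI SigmaI) (simp_all only: arcs_verts)
    show "sym (parcs ?H)"
      by (rule symI) (rule arcs_sym)
    show "a \<in> pverts ?H" by (simp add: verts)
    show "\<forall>v\<in>pverts ?H. x v = x a" if "\<And>u v. (u, v) \<in> parcs ?H \<Longrightarrow> x u = x v" for x :: "'a \<Rightarrow> real"
    proof
      have x: "x b = x a" "x c = x b" "x d = x c" "x f = x d" "\<And>v. v \<in> ?V \<Longrightarrow> x v = x a"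
        by (rule that, simp add: arcs)+
      fix v assume "v \<in> pverts ?H"
      then show "x v = x a"
        unfolding verts by (elim UnE insertE emptyE) (simp_all add: x)
    qed
  qed (rule cos_diff_pos)
  have "\<not> [\<theta> b = \<theta> a] (rmod (2 * pi))"
  proof
    assume "[\<theta> b = \<theta> a] (rmod (2 * pi))"
    then have "[s + s = - s + s] (rmod (2 * pi))"
      unfolding \<theta> by (subst rcong_add_right_cancel)
    then have "(2 * s) rmod (2 * pi) = 0"
      by (simp add: rcong_0_iff)
    moreover have "(2 * s) rmod (2 * pi) = 2 * s"
      using s(1,2) by (intro rmod_unique[where n = 0]) auto
    ultimately show False using s(1) by simp
  qed
  then show ?thesis
    using equi stable by (auto simp: exotic_solution_def verts intro!: exI[of _ \<theta>])
qed

theorem theorem3p7: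
  fixes G C :: "'a pair_pre_digraph" and e :: "'a \<times> 'a" and d :: nat
  assumes "pair_graph G" and "card (pverts G) = d" and "d \<ge> 1"
    and "is_cycle_graph 5 C"
    and "pverts G \<inter> pverts C = {}"
    and "e \<in> parcs C"
  shows "\<exists>\<theta>. exotic_solution (join_to_edge C e G) \<theta>"
proof -
  obtain a b c d f where "distinct [a, b, c, d, f]" "{fst e, snd e} = {a, b}"
    and C: "C = cycle_graph [a, b, c, d, f]"
    using five_cycle_edge_first assms(4,6) by metis
  moreover have "pverts G \<inter> {a, b, c, d, f} = {}"
    using assms(5) unfolding C cycle_graph_five by simp
  ultimately show ?thesis
    using join_to_edge_of_five_cycle_exotic[OF assms(1)] by blast
qed

end
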